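(* Every theorem of $IEL^-$ is true in all relational $IEL^-$-models, and every theorem of $IEL$ is true in all relational $IEL$-models.
   Context: $Fm_e$: formulas built from an infinite set $V$ of variables using $\bot,\wedge,\vee,\rightarrow$ and unary $K$ (no $\square$); $\neg\varphi:=\varphi\rightarrow\bot$. $IEL^-$ is the system over $Fm_e$ with axiom schemes: all theorems of intuitionistic propositional logic and their substitution-instances; $K(\varphi\rightarrow\psi)\rightarrow(K\varphi\rightarrow K\psi)$; $\varphi\rightarrow K\varphi$; and only inference rule Modus Ponens. $IEL$ is $IEL^-$ plus the axiom scheme $K\varphi\rightarrow\neg\neg\varphi$. An $IEL^-$-frame is $(W,R,P,E)$: $W$ nonempty; $R$ a partial order on $W$ with least element $w_\bot$ in which every chain has an upper bound; $R(w):=\{w': wRw'\}$; $Max(W)$ the $R$-maximal elements; $P$ a set of $R$-upward closed subsets of $W$; $E:W\to\mathcal P(P)$ with each $E(w)$ a filter on $P$ (nonempty, closed under $\cap$, upward closed in $P$) and $wRw'\Rightarrow E(w)\subseteq E(w')$; $\varnothing,W\in P$ and $P$ closed under $\cap$, $\cup$, $A\supset B:=\{w:\forall w'\in R(w)(w'\in A\Rightarrow w'\in B)\}$, $KA:=\{w: A\in E(w)\}$; and (IntCo): for all $w\in W$, $A\in P$, $w\in A$ implies $A\in E(w)$. An $IEL$-frame is an $IEL^-$-frame with $Max(W)\cap R(w)\subseteq A$ for all $w$ and all $A\in E(w)$. A relational $IEL^-$- (resp. $IEL$-) model is $\mathcal K=(\mathcal F,g)$ with $\mathcal F$ such a frame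 and $g:V\to P$. Satisfaction: $w\nvDash\bot$; $w\vDash x$ iff $w\in g(x)$; $\vee,\wedge$ pointwise; $w\vDash\varphi\rightarrow\psi$ iff for all $w'\in R(w)$, $w'\vDash\varphi\Rightarrow w'\vDash\psi$; $w\vDash K\varphi$ iff $\{w': w'\vDash\varphi\}\in E(w)$. A formula $\varphi$ is true in $\mathcal K$ iff $w_\bot\vDash\varphi$. *)

theory Defs
  imports Main
begin

section \<open>Formulas\<close>

text \<open>The set \<open>V\<close> of variables is the type \<open>'v\<close>; its infinity is assumed where needed.\<close>

datatype 'v fm =
    Bot ("\<^bold>\<bottom>")
  | Var 'v
  | And "'v fm" "'v fm" (infixr "\<^bold>\<and>" 75)
  | Or "'v fm" "'v fm" (infixr "\<^bold>\<or>" 70)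
  | Imp "'v fm" "'v fm" (infixr "\<^bold>\<rightarrow>" 65)
  | Know "'v fm" ("\<^bold>K _" [80] 80)

abbreviation Neg :: "'v fm \<Rightarrow> 'v fm" ("\<^bold>\<not> _" [80] 80)
  where "\<^bold>\<not> \<phi> \<equiv> \<phi> \<^bold>\<rightarrow> \<^bold>\<bottom>"

primrec subst :: "('v \<Rightarrow> 'v fm) \<Rightarrow> 'v fm \<Rightarrow> 'v fm" where
  "subst \<sigma> \<^bold>\<bottom> = \<^bold>\<bottom>"
| "subst \<sigma> (Var x) = \<sigma> x"
| "subst \<sigma> (\<phi> \<^bold>\<and> \<psi>) = subst \<sigma> \<phi> \<^bold>\<and> subst \<sigma> \<psi>"
| "subst \<sigma> (\<phi> \<^bold>\<or> \<psi>) = subst \<sigma> \<phi> \<^bold>\<or> subst \<sigma> \<psi>"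
| "subst \<sigma> (\<phi> \<^bold>\<rightarrow> \<psi>) = subst \<sigma> \<phi> \<^bold>\<rightarrow> subst \<sigma> \<psi>"
| "subst \<sigma> (\<^bold>K \<phi>) = \<^bold>K (subst \<sigma> \<phi>)"


section \<open>Deductive systems\<close>

text \<open>Propositional formulas are the \<open>K\<close>-free ones.\<close>

primrec propositional :: "'v fm \<Rightarrow> bool" where
  "propositional \<^bold>\<bottom> = True"
| "propositional (Var x) = True"
| "propositional (\<phi> \<^bold>\<and> \<psi>) = (propositional \<phi> \<and> propositional \<psi>)"
| "propositional (\<phi> \<^bold>\<or> \<psi>) = (propositional \<phi> \<and> propositional \<psi>)"
| "propositional (\<phi> \<^bold>\<rightarrow> \<psi>) = (propositional \<phi> \<and> propositional \<psi>)"
| "propositional (\<^bold>K \<phi>) = False"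

text \<open>The standard Hilbert axioms of intuitionistic propositional logic.\<close>

inductive IPC_axiom :: "'v fm \<Rightarrow> bool" where
  "IPC_axiom (\<phi> \<^bold>\<rightarrow> \<psi> \<^bold>\<rightarrow> \<phi>)"
| "IPC_axiom ((\<phi> \<^bold>\<rightarrow> \<psi> \<^bold>\<rightarrow> \<chi>) \<^bold>\<rightarrow> (\<phi> \<^bold>\<rightarrow> \<psi>) \<^bold>\<rightarrow> \<phi> \<^bold>\<rightarrow> \<chi>)"
| "IPC_axiom (\<phi> \<^bold>\<and> \<psi> \<^bold>\<rightarrow> \<phi>)"
| "IPC_axiom (\<phi> \<^bold>\<and> \<psi> \<^bold>\<rightarrow> \<psi>)"
| "IPC_axiom (\<phi> \<^bold>\<rightarrow> \<psi> \<^bold>\<rightarrow> \<phi> \<^bold>\<and> \<psi>)"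
| "IPC_axiom (\<phi> \<^bold>\<rightarrow> \<phi> \<^bold>\<or> \<psi>)"
| "IPC_axiom (\<psi> \<^bold>\<rightarrow> \<phi> \<^bold>\<or> \<psi>)"
| "IPC_axiom ((\<phi> \<^bold>\<rightarrow> \<chi>) \<^bold>\<rightarrow> (\<psi> \<^bold>\<rightarrow> \<chi>) \<^bold>\<rightarrow> \<phi> \<^bold>\<or> \<psi> \<^bold>\<rightarrow> \<chi>)"
| "IPC_axiom (\<^bold>\<bottom> \<^bold>\<rightarrow> \<phi>)"

inductive IPC_theorem :: "'v fm \<Rightarrow> bool" where
  "IPC_axiom \<phi> \<Longrightarrow> propositional \<phi> \<Longrightarrow> IPC_theorem \<phi>"
| "IPC_theorem \<phi> \<Longrightarrow> IPC_theorem (\<phi> \<^bold>\<rightarrow> \<psi>) \<Longrightarrow> IPC_theorem \<psi>"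

text \<open>
  \<open>IPC\<close> covers the theorems of intuitionistic propositional logic themselves, by \<open>\<sigma> = Var\<close>,
  together with their instances in the full language.
\<close>

inductive IELm_axiom :: "'v fm \<Rightarrow> bool" where
  IPC: "IPC_theorem \<phi> \<Longrightarrow> IELm_axiom (subst \<sigma> \<phi>)"
| K_dist: "IELm_axiom (\<^bold>K (\<phi> \<^bold>\<rightarrow> \<psi>) \<^bold>\<rightarrow> \<^bold>K \<phi> \<^bold>\<rightarrow> \<^bold>K \<psi>)"
| co_reflection: "IELm_axiom (\<phi> \<^bold>\<rightarrow> \<^bold>K \<phi>)"

inductive IEL_axiom :: "'v fm \<Rightarrow> bool" where
  IELm: "IELm_axiom \<phi> \<Longrightarrow> IEL_axiom \<phi>"
| int_reflection: "IEL_axiom (\<^bold>K \<phi> \<^bold>\<rightarrow> \<^bold>\<not> \<^bold>\<not> \<phi>)"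

inductive IELm_theorem :: "'v fm \<Rightarrow> bool" where
  "IELm_axiom \<phi> \<Longrightarrow> IELm_theorem \<phi>"
| "IELm_theorem \<phi> \<Longrightarrow> IELm_theorem (\<phi> \<^bold>\<rightarrow> \<psi>) \<Longrightarrow> IELm_theorem \<psi>"

inductive IEL_theorem :: "'v fm \<Rightarrow> bool" where
  "IEL_axiom \<phi> \<Longrightarrow> IEL_theorem \<phi>"
| "IEL_theorem \<phi> \<Longrightarrow> IEL_theorem (\<phi> \<^bold>\<rightarrow> \<psi>) \<Longrightarrow> IEL_theorem \<psi>"


section \<open>Frames and models\<close>

record 'w frame =
  worlds :: "'w set"
  acc :: "('w \<times> 'w) set"
  props :: "'w set set"
  nbhd :: "'w \<Rightarrow> 'w set set"

definition is_least :: "'w frame \<Rightarrow> 'w \<Rightarrow> bool" where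
  "is_least F b \<longleftrightarrow> b \<in> worlds F \<and> (\<forall>w\<in>worlds F. (b, w) \<in> acc F)"

definition root :: "'w frame \<Rightarrow> 'w" where
  "root F = (THE b. is_least F b)"

definition Max_worlds :: "'w frame \<Rightarrow> 'w set" where
  "Max_worlds F = {w \<in> worlds F. \<forall>w'\<in>worlds F. (w, w') \<in> acc F \<longrightarrow> w' = w}"

definition up_closed :: "'w frame \<Rightarrow> 'w set \<Rightarrow> bool" where
  "up_closed F A \<longleftrightarrow> (\<forall>w w'. w \<in> A \<longrightarrow> (w, w') \<in> acc F \<longrightarrow> w' \<in> A)"

definition filter_on :: "'w set set \<Rightarrow> 'w set set \<Rightarrow> bool" where
  "filter_on P G \<longleftrightarrow> G \<subseteq> P \<and> G \<noteq> {} \<and> (\<forall>A\<in>G. \<forall>B\<in>G. A \<inter> B \<in> G) \<and>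
     (\<forall>A\<in>G. \<forall>B\<in>P. A \<subseteq> B \<longrightarrow> B \<in> G)"

definition imp_set :: "'w frame \<Rightarrow> 'w set \<Rightarrow> 'w set \<Rightarrow> 'w set" where
  "imp_set F A B = {w \<in> worlds F. \<forall>w'\<in>acc F `` {w}. w' \<in> A \<longrightarrow> w' \<in> B}"

definition K_set :: "'w frame \<Rightarrow> 'w set \<Rightarrow> 'w set" where
  "K_set F A = {w \<in> worlds F. A \<in> nbhd F w}"

locale IELm_frame =
  fixes F :: "'w frame"
  assumes nonempty: "worlds F \<noteq> {}"
    and order: "partial_order_on (worlds F) (acc F)"
    and least: "\<exists>b. is_least F b"
    and chain_bound: "C \<in> Chains (acc F) \<Longrightarrow> \<exists>u\<in>worlds F. \<forall>c\<in>C. (c, u) \<in> acc F"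
    and props_subset: "A \<in> props F \<Longrightarrow> A \<subseteq> worlds F"
    and props_up: "A \<in> props F \<Longrightarrow> up_closed F A"
    and nbhd_filter: "w \<in> worlds F \<Longrightarrow> filter_on (props F) (nbhd F w)"
    and nbhd_mono: "(w, w') \<in> acc F \<Longrightarrow> nbhd F w \<subseteq> nbhd F w'"
    and empty_prop: "{} \<in> props F"
    and worlds_prop: "worlds F \<in> props F"
    and inter_prop: "A \<in> props F \<Longrightarrow> B \<in> props F \<Longrightarrow> A \<inter> B \<in> props F"
    and union_prop: "A \<in> props F \<Longrightarrow> B \<in> props F \<Longrightarrow> A \<union> B \<in> props F"
    and imp_prop: "A \<in> props F \<Longrightarrow> B \<in> props F \<Longrightarrow> imp_set F A B \<in> props F"
    and K_prop: "A \<in> props F \<Longrightarrow> K_set F A \<in> props F"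
    and IntCo: "w \<in> worlds F \<Longrightarrow> A \<in> props F \<Longrightarrow> w \<in> A \<Longrightarrow> A \<in> nbhd F w"

locale IEL_frame = IELm_frame +
  assumes Max_subset: "w \<in> worlds F \<Longrightarrow> A \<in> nbhd F w \<Longrightarrow> Max_worlds F \<inter> acc F `` {w} \<subseteq> A"

definition IELm_model :: "'w frame \<Rightarrow> ('v \<Rightarrow> 'w set) \<Rightarrow> bool" where
  "IELm_model F g \<longleftrightarrow> IELm_frame F \<and> (\<forall>x. g x \<in> props F)"

definition IEL_model :: "'w frame \<Rightarrow> ('v \<Rightarrow> 'w set) \<Rightarrow> bool" where
  "IEL_model F g \<longleftrightarrow> IEL_frame F \<and> (\<forall>x. g x \<in> props F)"

primrec sat :: "'w frame \<Rightarrow> ('v \<Rightarrow> 'w set) \<Rightarrow> 'v fm \<Rightarrow> 'w \<Rightarrow> bool" where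
  "sat F g \<^bold>\<bottom> w \<longleftrightarrow> False"
| "sat F g (Var x) w \<longleftrightarrow> w \<in> g x"
| "sat F g (\<phi> \<^bold>\<and> \<psi>) w \<longleftrightarrow> sat F g \<phi> w \<and> sat F g \<psi> w"
| "sat F g (\<phi> \<^bold>\<or> \<psi>) w \<longleftrightarrow> sat F g \<phi> w \<or> sat F g \<psi> w"
| "sat F g (\<phi> \<^bold>\<rightarrow> \<psi>) w \<longleftrightarrow> (\<forall>w'\<in>acc F `` {w}. sat F g \<phi> w' \<longrightarrow> sat F g \<psi> w')"
| "sat F g (\<^bold>K \<phi>) w \<longleftrightarrow> {w' \<in> worlds F. sat F g \<phi> w'} \<in> nbhd F w"

definition true_in :: "'w frame \<Rightarrow> ('v \<Rightarrow> 'w set) \<Rightarrow> 'v fm \<Rightarrow> bool" where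
  "true_in F g \<phi> \<longleftrightarrow> sat F g \<phi> (root F)"

end

theory Submission
  imports Defs
begin

text \<open>
  Truth sets are propositions, hence upward closed, and this makes every axiom hold at every
  world. Intuitionistic reflection is the only axiom that needs Zorn's lemma: every world sees a
  maximal world, and a maximal world above \<open>w\<close> lies in every member of \<open>E(w)\<close>, so a world
  satisfying \<open>K\<phi>\<close> cannot satisfy \<open>\<not>\<phi>\<close>.
\<close>

text \<open>This is the set tested by the \<open>Know\<close> clause of \<open>sat\<close>; under a
  name it can be treated as an element of \<open>props F\<close>.\<close>

definition truth_set :: "'w frame \<Rightarrow> ('v \<Rightarrow> 'w set) \<Rightarrow> 'v fm \<Rightarrow> 'w set" where
  "truth_set F g \<phi> = {w \<in> worlds F. sat F g \<phi> w}"

context IELm_frame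
begin

lemma acc_worlds: "(w, w') \<in> acc F \<Longrightarrow> w \<in> worlds F \<and> w' \<in> worlds F"
  using order unfolding partial_order_on_def preorder_on_def by auto

lemma acc_refl: "w \<in> worlds F \<Longrightarrow> (w, w) \<in> acc F"
  using order unfolding partial_order_on_def preorder_on_def refl_on_def by auto

lemma acc_trans: "(u, v) \<in> acc F \<Longrightarrow> (v, w) \<in> acc F \<Longrightarrow> (u, w) \<in> acc F"
  using order unfolding partial_order_on_def preorder_on_def by (auto dest: transD)

lemma acc_antisym: "(u, v) \<in> acc F \<Longrightarrow> (v, u) \<in> acc F \<Longrightarrow> u = v"
  using order unfolding partial_order_on_def by (auto dest: antisymD)

lemma root_in_worlds: "root F \<in> worlds F"
proof -
  \<comment> \<open>Antisymmetry makes the least world unique, so the \<open>THE\<close> in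
    \<open>root\<close> denotes it.\<close>
  have "\<exists>!b. is_least F b"
    using least acc_antisym unfolding is_least_def by blast
  then have "is_least F (root F)"
    unfolding root_def by (rule theI')
  then show ?thesis
    by (simp add: is_least_def)
qed

text \<open>Each clause of \<open>sat\<close> mirrors one closure condition on
  \<open>props F\<close>, so induction on the formula suffices.\<close>

lemma truth_set_in_props:
  assumes g: "\<forall>x. g x \<in> props F"
  shows "truth_set F g \<phi> \<in> props F"
proof (induction \<phi>)
  case Bot
  then show ?case by (simp add: truth_set_def empty_prop)
next
  case (Var x)
  have "truth_set F g (Var x) = g x"
    using g props_subset by (auto simp: truth_set_def)
  with g show ?case by simp
next
  case (And \<phi> \<psi>)
  have "truth_set F g (And \<phi> \<psi>) = truth_set F g \<phi> \<inter> truth_set F g \<psi>"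
    by (auto simp: truth_set_def)
  with And show ?case by (simp add: inter_prop)
next
  case (Or \<phi> \<psi>)
  have "truth_set F g (Or \<phi> \<psi>) = truth_set F g \<phi> \<union> truth_set F g \<psi>"
    by (auto simp: truth_set_def)
  with Or show ?case by (simp add: union_prop)
next
  case (Imp \<phi> \<psi>)
  have "truth_set F g (Imp \<phi> \<psi>) = imp_set F (truth_set F g \<phi>) (truth_set F g \<psi>)"
    using acc_worlds by (auto simp: truth_set_def imp_set_def)
  with Imp show ?case by (simp add: imp_prop)
next
  case (Know \<phi>)
  have "truth_set F g (Know \<phi>) = K_set F (truth_set F g \<phi>)"
    by (auto simp: truth_set_def K_set_def)
  with Know show ?case by (simp add: K_prop)
qed

text \<open>Persistence needs no induction of its own: truth sets are propositions, and these are
  upward closed.\<close>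

lemma sat_mono:
  assumes "\<forall>x. g x \<in> props F" and "(w, w') \<in> acc F" and "sat F g \<phi> w"
  shows "sat F g \<phi> w'"
  using props_up[OF truth_set_in_props[OF assms(1), of \<phi>]] assms(2,3) acc_worlds
  unfolding up_closed_def truth_set_def by blast

lemma sat_modus_ponens:
  "w \<in> worlds F \<Longrightarrow> sat F g \<phi> w \<Longrightarrow> sat F g (Imp \<phi> \<psi>) w \<Longrightarrow> sat F g \<psi> w"
  using acc_refl by auto

text \<open>Substitution commutes with the connectives, so an instance of an axiom has the same
  shape again. Any \<open>w\<close> is allowed, since the outermost implication only speaks of
  successors, which are worlds. Persistence settles cases 1 and 5.\<close>

lemma sat_subst_IPC_axiom:
  assumes g: "\<forall>x. g x \<in> props F" and "IPC_axiom \<theta>"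
  shows "sat F g (subst \<sigma> \<theta>) w"
  using assms(2)
proof cases
  case (1 \<phi> \<psi>)
  then show ?thesis by (auto intro: sat_mono[OF g])
next
  case (2 \<phi> \<psi> \<chi>)
  have "sat F g (subst \<sigma> \<chi>) w3"
    if "(w1, w2) \<in> acc F" and w23: "(w2, w3) \<in> acc F"
      and "sat F g (subst \<sigma> (Imp \<phi> (Imp \<psi> \<chi>))) w1"
      and "sat F g (subst \<sigma> (Imp \<phi> \<psi>)) w2"
      and "sat F g (subst \<sigma> \<phi>) w3" for w1 w2 w3
  proof -
    \<comment> \<open>The premise at \<open>w1\<close> is a nested implication: its outer step goes
      to \<open>w3\<close>, its inner step stays there by reflexivity.\<close>
    have "(w1, w3) \<in> acc F" "(w3, w3) \<in> acc F"
      using that(1) w23 acc_trans acc_refl acc_worlds by blast+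
    with that show ?thesis by simp
  qed
  with 2 show ?thesis by simp
next
  case (5 \<phi> \<psi>)
  then show ?thesis by (auto intro: sat_mono[OF g])
next
  case (8 \<phi> \<chi> \<psi>)
  then show ?thesis by (clarsimp simp: Ball_def, metis acc_trans)
qed simp_all

lemma sat_subst_IPC_theorem:
  assumes g: "\<forall>x. g x \<in> props F" and "IPC_theorem \<phi>" and w: "w \<in> worlds F"
  shows "sat F g (subst \<sigma> \<phi>) w"
  using assms(2)
proof induction
  case (1 \<phi>)
  then show ?case by (simp add: sat_subst_IPC_axiom[OF g])
next
  case (2 \<phi> \<psi>)
  then show ?case using sat_modus_ponens[OF w] by simp
qed

text \<open>Knowledge of the implication passes from \<open>u\<close> to \<open>v\<close> by
  \<open>nbhd_mono\<close>; at \<open>v\<close> the filter contains the intersection of both truth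
  sets, hence the truth set of \<psi>, which is a proposition.\<close>

lemma sat_K_dist:
  assumes g: "\<forall>x. g x \<in> props F"
  shows "sat F g (Imp (Know (Imp \<phi> \<psi>)) (Imp (Know \<phi>) (Know \<psi>))) w"
proof -
  have "truth_set F g \<psi> \<in> nbhd F v"
    if uv: "(u, v) \<in> acc F" and imp: "truth_set F g (Imp \<phi> \<psi>) \<in> nbhd F u"
      and ant: "truth_set F g \<phi> \<in> nbhd F v" for u v
  proof -
    have v: "v \<in> worlds F" using uv acc_worlds by blast
    have imp': "truth_set F g (Imp \<phi> \<psi>) \<in> nbhd F v"
      using imp nbhd_mono[OF uv] by blast
    have sub: "truth_set F g (Imp \<phi> \<psi>) \<inter> truth_set F g \<phi> \<subseteq> truth_set F g \<psi>"
      using sat_modus_ponens by (auto simp: truth_set_def simp del: sat.simps)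
    show ?thesis
      using nbhd_filter[OF v] imp' ant sub truth_set_in_props[OF g, of \<psi>]
      unfolding filter_on_def by blast
  qed
  then show ?thesis by (auto simp: truth_set_def)
qed

lemma sat_co_reflection:
  assumes g: "\<forall>x. g x \<in> props F"
  shows "sat F g (Imp \<phi> (Know \<phi>)) w"
proof -
  have "truth_set F g \<phi> \<in> nbhd F v" if "v \<in> worlds F" "sat F g \<phi> v" for v
    using IntCo truth_set_in_props[OF g] that by (simp add: truth_set_def)
  then show ?thesis
    using acc_worlds by (auto simp: truth_set_def)
qed

lemma sat_IELm_axiom:
  assumes g: "\<forall>x. g x \<in> props F" and "IELm_axiom \<phi>" and w: "w \<in> worlds F"
  shows "sat F g \<phi> w"
  using assms(2)
proof cases
  case (IPC \<phi>' \<sigma>)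
  then show ?thesis using sat_subst_IPC_theorem[OF g _ w] by simp
qed (simp_all only: sat_K_dist[OF g] sat_co_reflection[OF g])

lemma sat_IELm_theorem:
  assumes g: "\<forall>x. g x \<in> props F" and "IELm_theorem \<phi>" and w: "w \<in> worlds F"
  shows "sat F g \<phi> w"
  using assms(2)
proof induction
  case (1 \<phi>)
  then show ?case by (simp add: sat_IELm_axiom[OF g _ w])
next
  case (2 \<phi> \<psi>)
  then show ?case using sat_modus_ponens[OF w] by blast
qed

text \<open>Zorn's lemma is applied to the cone \<open>U\<close> of worlds above \<open>w\<close>,
  so that the maximal element found is one that \<open>w\<close> sees.\<close>

lemma ex_Max_worlds_above:
  assumes w: "w \<in> worlds F"
  obtains m where "m \<in> Max_worlds F" and "(w, m) \<in> acc F"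
proof -
  define U where "U = acc F `` {w}"
  define r where "r = acc F \<inter> U \<times> U"
  have wU: "w \<in> U" using acc_refl[OF w] by (simp add: U_def)
  have U_up: "v' \<in> U" if "v \<in> U" "(v, v') \<in> acc F" for v v'
    using that acc_trans by (auto simp: U_def)
  have rr: "(v, v) \<in> r" if "v \<in> U" for v
    using that acc_refl acc_worlds by (auto simp: r_def U_def)
  have field: "Field r = U"
  proof
    show "Field r \<subseteq> U" by (auto simp: r_def Field_def)
    show "U \<subseteq> Field r" using rr by (blast intro: FieldI1)
  qed
  have po: "Partial_order r"
    unfolding field partial_order_on_def preorder_on_def
  proof (intro conjI)
    show "r \<subseteq> U \<times> U" by (simp add: r_def)
    show "refl_on U r" using rr by (simp add: refl_on_def)
    show "trans r" unfolding trans_def r_def using acc_trans by blast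
    show "antisym r" unfolding antisym_def r_def using acc_antisym by blast
  qed
  have bound: "\<exists>u\<in>Field r. \<forall>c\<in>C. (c, u) \<in> r" if C: "C \<in> Chains r" for C
  \<comment> \<open>A bound of the empty chain need not lie above \<open>w\<close>, so
    \<open>w\<close> itself is taken. A bound of a nonempty chain lies above some member of
    \<open>U\<close>, hence in \<open>U\<close>.\<close>
  proof (cases "C = {}")
    case True
    then show ?thesis using wU field by blast
  next
    case False
    have CU: "C \<subseteq> U" using C unfolding Chains_def r_def by blast
    have "C \<in> Chains (acc F)" using C unfolding Chains_def r_def by blast
    then obtain u where u: "\<forall>c\<in>C. (c, u) \<in> acc F" using chain_bound by blast
    with False CU U_up have "u \<in> U" by blast
    moreover from this u CU have "\<forall>c\<in>C. (c, u) \<in> r"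
      by (auto simp: r_def)
    ultimately show ?thesis using field by blast
  qed
  obtain m where m: "m \<in> U" and max: "\<forall>a\<in>U. (m, a) \<in> r \<longrightarrow> a = m"
    using Zorns_po_lemma[OF po bound] field by blast
  \<comment> \<open>Every world above \<open>m\<close> is again in \<open>U\<close>, so maximality
    in the cone is maximality in the frame.\<close>
  have "m \<in> Max_worlds F"
    using m max U_up acc_worlds unfolding Max_worlds_def r_def U_def by blast
  with m that show ?thesis by (simp add: U_def)
qed

end

context IEL_frame
begin

lemma sat_int_reflection:
  assumes g: "\<forall>x. g x \<in> props F"
  shows "sat F g (Imp (Know \<phi>) (Neg (Neg \<phi>))) w"
proof -
  \<comment> \<open>This is what double negation at \<open>u\<close> requires: no \<open>v\<close>
    above \<open>u\<close> satisfies the negation of \<phi>, because it sees some \<open>m\<close>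
    where \<phi> holds.\<close>
  have "\<exists>m. (v, m) \<in> acc F \<and> sat F g \<phi> m"
    if uv: "(u, v) \<in> acc F" and K: "truth_set F g \<phi> \<in> nbhd F u" for u v
  proof -
    obtain m where m: "m \<in> Max_worlds F" "(v, m) \<in> acc F"
      using ex_Max_worlds_above acc_worlds[OF uv] by blast
    then have "m \<in> truth_set F g \<phi>"
      using Max_subset[OF _ K] acc_worlds[OF uv] acc_trans[OF uv] by blast
    with m show ?thesis by (auto simp: truth_set_def)
  qed
  then show ?thesis by (simp add: truth_set_def) blast
qed

lemma sat_IEL_theorem:
  assumes g: "\<forall>x. g x \<in> props F" and "IEL_theorem \<phi>" and w: "w \<in> worlds F"
  shows "sat F g \<phi> w"
  using assms(2)
proof induction
  case (1 \<phi>)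
  then show ?case
    by cases (simp_all only: sat_IELm_axiom[OF g _ w] sat_int_reflection[OF g])
next
  case (2 \<phi> \<psi>)
  then show ?case using sat_modus_ponens[OF w] by blast
qed

end

theorem theorem5p4:
  assumes "infinite (UNIV :: 'v set)"
  shows "(\<forall>\<phi> :: 'v fm. IELm_theorem \<phi> \<longrightarrow>
            (\<forall>(F :: 'w frame) g. IELm_model F g \<longrightarrow> true_in F g \<phi>)) \<and>
         (\<forall>\<phi> :: 'v fm. IEL_theorem \<phi> \<longrightarrow>
            (\<forall>(F :: 'w frame) g. IEL_model F g \<longrightarrow> true_in F g \<phi>))"
proof (intro conjI allI impI)
  fix \<phi> :: "'v fm" and F :: "'w frame" and g :: "'v \<Rightarrow> 'w set"
  assume "IELm_theorem \<phi>" "IELm_model F g"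
  then show "true_in F g \<phi>"
    unfolding IELm_model_def true_in_def
    by (simp add: IELm_frame.sat_IELm_theorem IELm_frame.root_in_worlds)
next
  fix \<phi> :: "'v fm" and F :: "'w frame" and g :: "'v \<Rightarrow> 'w set"
  assume prov: "IEL_theorem \<phi>" and model: "IEL_model F g"
  \<comment> \<open>The interpretation also supplies the facts of \<open>IELm_frame\<close>; truth
    at every world is then specialized to the root.\<close>
  then interpret IEL_frame F by (simp add: IEL_model_def)
  show "true_in F g \<phi>"
    using prov model sat_IEL_theorem root_in_worlds
    unfolding IEL_model_def true_in_def by blast
qed

end
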